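(* Let $p\ge 2$ and $q$ be positive integers with $\gcd(p,q)=1$ and $p/q<1/2$, and write $q=mp+r$ with $m=\lfloor q/p\rfloor$ and $r\in\{1,\dots,p-1\}$. Consider the circular billiard trajectory with angle $\vartheta=\frac{p}{q}\cdot 2\pi$. Let $f_n$ be the number of regions into which the disk is divided after $n$ straight paths of the trajectory, and let $f_{total}$ be the number of regions after the full periodic orbit. Then the number of regions is given by $$f_{total}=1+\left(\sum_{n=1}^{m+\lfloor \frac{r}{p}\rfloor}1\right)+2+\left(\sum_{n=m+2+\lfloor \frac{r}{p}\rfloor}^{2m+\lfloor \frac{2r}{p}\rfloor}3\right)+4+\left(\sum_{n=2m+2+\lfloor \frac{2r}{p}\rfloor}^{3m+\lfloor \frac{3r}{p}\rfloor}5\right)+\dots+\left(\sum_{n=(p-1)m+2+\lfloor \frac{(p-1)r}{p}\rfloor}^{pm+r+1}(2p-1)\right),$$ where the dots continue the pattern: for $k=2,\dots,p$ a single term $2(k-1)$ is followed by a sum of terms $2k-1$ starting at $n=(k-1)m+2+\lfloor\frac{(k-1)r}{p}\rfloor$, and this sum ends at $n=km+\lfloor\frac{kr}{p}\rfloor$ if $k<p$. The last sum ($k=p$) runs to $pm+r+1$ instead of $pm+r$, i.e. there is one additional summand $2p-1$, resulting from the fact that the very last path ends exactly on the initial point $P_0$ and thus crosses the same number of lines as the paths before. The associated division sequence $f_n$ starts at $f_0=1$ and has the following successive increments: $+1$ exactly $m$ times, reaching $m+1$; then $+2$ once, reaching $m+3$; then $+3$ exactly $m-1+\lfloor\frac{2r}{p}\rfloor-\lfloor\frac{r}{p}\rfloor$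 times, reaching $m+3+3\left(m-1+\lfloor\frac{2r}{p}\rfloor-\lfloor\frac{r}{p}\rfloor\right)$; then $+4$ once; and so on, ending with $+(2p-1)$ exactly $m-1+\lfloor\frac{pr}{p}\rfloor-\lfloor\frac{(p-1)r}{p}\rfloor$ times, reaching the final value $p(mp+r)+1=pq+1$.
   Context: Circular billiard. A point particle moves with unit velocity inside a circle of radius $R>0$ and is reflected elastically at the boundary; $\vartheta$ is the central angle between two consecutive reflection points. For positive integers $p,q$ with $\gcd(p,q)=1$ and $p/q<1/2$, put $P_i=\left(R\cos\frac{2\pi i}{q},\,R\sin\frac{2\pi i}{q}\right)$ for $i\in\mathbb{Z}$ (indices modulo $q$). The trajectory with angle $\vartheta=\frac{p}{q}\cdot 2\pi$ started at $P_0$ successively traverses the straight paths (chords) from $P_{p(n-1)}$ to $P_{pn}$, $n=1,\dots,q$, and after $q$ paths it returns to $P_0$, completing the periodic orbit. The regions counted by $f_n$ are the connected pieces into which the first $n$ chords divide the disk; $f_0=1$.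
   Formalization: The last sum is taken up to n = pm+r, not pm+r+1 with "one additional summand 2p-1": the printed limit gives pq+1+(2p-1), contradicting the final value pq+1 (for p=2, q=5 it gives 14 instead of the true 11). *)

theory Defs
  imports "HOL-Analysis.Analysis"
begin

definition boundary_point :: "real \<Rightarrow> nat \<Rightarrow> int \<Rightarrow> real \<times> real" where
  "boundary_point R q i =
     (R * cos (2 * pi * of_int i / of_nat q), R * sin (2 * pi * of_int i / of_nat q))"

text \<open>The \<open>n\<close>-th straight path (\<open>n \<ge> 1\<close>) of the trajectory with central angle
  \<open>2 * pi * p / q\<close> started at \<open>boundary_point R q 0\<close>.\<close>

definition straight_path :: "real \<Rightarrow> nat \<Rightarrow> nat \<Rightarrow> nat \<Rightarrow> (real \<times> real) set" where
  "straight_path R p q n =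
     closed_segment (boundary_point R q (int p * (int n - 1))) (boundary_point R q (int p * int n))"

text \<open>The disk is taken to be open, so that the points of the circle itself play no role. The norm
  on \<open>real \<times> real\<close> is the Euclidean one.\<close>

definition num_regions :: "real \<Rightarrow> nat \<Rightarrow> nat \<Rightarrow> nat \<Rightarrow> nat" where
  "num_regions R p q n =
     card (components (ball (0, 0) R - (\<Union>k\<in>{1..n}. straight_path R p q k)))"

text \<open>The full periodic orbit consists of \<open>q\<close> paths.\<close>

definition num_regions_total :: "real \<Rightarrow> nat \<Rightarrow> nat \<Rightarrow> nat" where
  "num_regions_total R p q = num_regions R p q q"

text \<open>The increments \<open>f 1 - f 0, \<dots>, f N - f (N - 1)\<close>, as integers to avoid truncated subtraction.\<close>

definition increments :: "(nat \<Rightarrow> nat) \<Rightarrow> nat \<Rightarrow> int list" where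
  "increments f N = map (\<lambda>n. int (f n) - int (f (n - 1))) [1..<N + 1]"

text \<open>The points are indexed modulo \<open>q\<close>; in particular the orbit closes after \<open>q\<close> paths.\<close>

lemma boundary_point_periodic:
  assumes "q > 0"
  shows "boundary_point R q (i + int q * j) = boundary_point R q i"
proof -
  have "2 * pi * of_int (i + int q * j) / of_nat q = 2 * pi * of_int i / of_nat q + 2 * pi * of_int j"
    using assms by (simp add: field_simps)
  then show ?thesis
    by (simp add: boundary_point_def cos_add sin_add)
qed

text \<open>Consecutive straight paths obey the law of elastic reflection: the outgoing direction \<open>d'\<close> is
  the mirror image of the incoming direction \<open>d\<close> in the tangent to the circle at the point of
  reflection. As all paths have the same length, the directions need not be normalised.\<close>

lemma boundary_point_reflection:
  fixes R :: real and p q :: nat and i :: int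
  defines "P \<equiv> boundary_point R q i"
  defines "d \<equiv> P - boundary_point R q (i - int p)"
    and "d' \<equiv> boundary_point R q (i + int p) - P"
  assumes "R > 0"
  shows "d' = d - (2 * (d \<bullet> P) / R\<^sup>2) *\<^sub>R P" and "norm d' = norm d"
proof -
  define a where "a = 2 * pi * of_int i / of_nat q"
  define t where "t = 2 * pi * of_nat p / of_nat q"
  have plus: "2 * pi * of_int (i + int p) / of_nat q = a + t"
    by (simp add: a_def t_def add_divide_distrib distrib_left)
  have minus: "2 * pi * of_int (i - int p) / of_nat q = a - t"
    by (simp add: a_def t_def diff_divide_distrib right_diff_distrib)
  have P: "P = (R * cos a, R * sin a)"
    by (simp add: P_def boundary_point_def a_def)
  have d: "d = (R * cos a - R * cos (a - t), R * sin a - R * sin (a - t))"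
    unfolding d_def P boundary_point_def minus by simp
  have d': "d' = (R * cos (a + t) - R * cos a, R * sin (a + t) - R * sin a)"
    unfolding d'_def P boundary_point_def plus by simp
  have one: "cos a * cos a = 1 - sin a * sin a"
    using sin_cos_squared_add[of a] by (simp add: power2_eq_square)
  have "d \<bullet> P = R\<^sup>2 * ((cos a * cos a + sin a * sin a) * (1 - cos t))"
    unfolding d P inner_Pair inner_real_def cos_diff sin_diff by algebra
  then have dP: "d \<bullet> P = R\<^sup>2 * (1 - cos t)"
    by (simp add: one)
  have coeff: "2 * (d \<bullet> P) / R\<^sup>2 = 2 - 2 * cos t"
    using \<open>R > 0\<close> by (simp add: dP)
  have eq: "d' = d - (2 - 2 * cos t) *\<^sub>R P"
    unfolding d d' P by (simp add: cos_diff sin_diff cos_add sin_add algebra_simps)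
  then show "d' = d - (2 * (d \<bullet> P) / R\<^sup>2) *\<^sub>R P"
    by (simp only: coeff)
  have PP: "P \<bullet> P = R\<^sup>2"
    unfolding P inner_Pair inner_real_def using one by algebra
  have "d' \<bullet> d' = d \<bullet> d - 2 * (2 - 2 * cos t) * (d \<bullet> P) + (2 - 2 * cos t)\<^sup>2 * (P \<bullet> P)"
    unfolding eq
    by (simp add: inner_diff_left inner_diff_right inner_commute algebra_simps power2_eq_square)
  also have "\<dots> = d \<bullet> d"
    unfolding dP PP by (simp add: algebra_simps power2_eq_square)
  finally have "d' \<bullet> d' = d \<bullet> d" .
  then show "norm d' = norm d"
    by (simp add: norm_eq_sqrt_inner)
qed

text \<open>A pitfall in the closed formula for the total. Path number \<open>n\<close> contributes the \<open>n\<close>-th summand,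
  and the very last path, \<open>n = q = p * m + r\<close>, crosses as many lines as the paths directly before
  it; hence the last sum of terms \<open>2 * p - 1\<close> includes \<open>n = p * m + r\<close>. It does not extend to
  \<open>n = p * m + r + 1\<close>, as is sometimes written: there is no such path, and the value would exceed
  the number of regions \<open>p * q + 1\<close> by \<open>2 * p - 1\<close>. For \<open>p = 2\<close>, \<open>q = 5\<close> (\<open>m = 2\<close>, \<open>r = 1\<close>) the
  increments are \<open>1, 1, 2, 3, 3\<close> and the number of regions is 11, whereas the longer sum gives 14:\<close>

lemma
  fixes total :: "nat \<Rightarrow> nat"
  assumes "\<And>last. total last =
    1 + (\<Sum>n = 1..2 + 1 div (2::nat). 1) + 2 + (\<Sum>n = 1 * 2 + 2 + 1 div 2..last. 3)"
  shows "total (2 * 2 + 1) = 2 * 5 + 1" and "total (2 * 2 + 1 + 1) = 14"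
  by (simp_all add: assms)

end

theory Submission
  imports Defs
begin

text \<open>Inside the disk each path coincides with a full line, so the regions are the cells of a line
  arrangement, that is, the realised sign vectors. A new line cuts every old cell that it meets into
  two, and these cells correspond to the pieces into which the old lines cut the new chord. All
  chords are tangent to one circle, and at most two tangents pass through a point outside it; hence
  there are no triple points and path \<open>n + 1\<close> adds one region plus one for each earlier path that it
  crosses. It crosses path \<open>n + 1 - d\<close> iff the residue of \<open>p * d\<close> modulo \<open>q\<close> is less than \<open>p\<close>
  or greater than \<open>q - p\<close>, and counting such \<open>d \<le> n\<close> telescopes to
  \<open>p * n div q + (p * (n + 1) - 1) div q\<close>.\<close>

section \<open>Cells of a hyperplane arrangement in a convex set\<close>

definition off_planes :: "('i \<Rightarrow> 'a::real_inner) \<Rightarrow> ('i \<Rightarrow> real) \<Rightarrow> 'i set \<Rightarrow> 'a set" where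
  "off_planes a b I = {x. \<forall>k\<in>I. a k \<bullet> x \<noteq> b k}"

text \<open>For a point off all hyperplanes this index set determines the whole sign vector.\<close>

definition positive_sides :: "('i \<Rightarrow> 'a::real_inner) \<Rightarrow> ('i \<Rightarrow> real) \<Rightarrow> 'i set \<Rightarrow> 'a \<Rightarrow> 'i set" where
  "positive_sides a b I x = {k\<in>I. b k < a k \<bullet> x}"

text \<open>The set \<open>X\<close> is a parameter because both the disk and a single chord are cut
  up in this way.\<close>

definition num_cells :: "('i \<Rightarrow> 'a::real_inner) \<Rightarrow> ('i \<Rightarrow> real) \<Rightarrow> 'a set \<Rightarrow> 'i set \<Rightarrow> nat" where
  "num_cells a b X I = card (positive_sides a b I ` (X \<inter> off_planes a b I))"

text \<open>Strict inequalities between continuous functions survive small moves, and finitely many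
  of them survive together.\<close>

lemma positive_sides_locally_constant:
  assumes "finite I" "x \<in> off_planes a b I"
  shows "\<forall>\<^sub>F y in nhds x. y \<in> off_planes a b I \<and> positive_sides a b I y = positive_sides a b I x"
proof -
  have "\<forall>\<^sub>F y in nhds x. a k \<bullet> y \<noteq> b k \<and> (b k < a k \<bullet> y \<longleftrightarrow> b k < a k \<bullet> x)" if "k \<in> I" for k
  proof -
    have lim: "((\<lambda>y. a k \<bullet> y) \<longlongrightarrow> a k \<bullet> x) (nhds x)"
      by (intro tendsto_intros filterlim_ident)
    from assms that consider "b k < a k \<bullet> x" | "a k \<bullet> x < b k"
      by (force simp: off_planes_def)
    then show ?thesis
    proof cases
      case 1
      then show ?thesis using order_tendstoD(1)[OF lim 1] by (auto elim!: eventually_mono)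
    next
      case 2
      then show ?thesis using order_tendstoD(2)[OF lim 2] by (auto elim!: eventually_mono)
    qed
  qed
  then have "\<forall>\<^sub>F y in nhds x. \<forall>k\<in>I. a k \<bullet> y \<noteq> b k \<and> (b k < a k \<bullet> y \<longleftrightarrow> b k < a k \<bullet> x)"
    using assms by (simp add: eventually_ball_finite)
  then show ?thesis
    by (rule eventually_mono) (auto simp: off_planes_def positive_sides_def)
qed

text \<open>A cell of \<open>X\<close> that meets the new hyperplane is cut into two, and these cells correspond to the
  cells of \<open>X \<inter> H\<close>. The vector \<open>v\<close> makes \<open>X\<close> open transversally to \<open>H\<close>, so that the lemma
  applies to chords as well as to the disk.\<close>

lemma num_cells_insert:
  fixes a :: "'i \<Rightarrow> 'a::real_inner"
  assumes fin: "finite I" and "n \<notin> I" and X: "convex X"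
    and trans: "\<And>x. x \<in> X \<Longrightarrow> a n \<bullet> x = b n \<Longrightarrow>
                  \<exists>v. a n \<bullet> v > 0 \<and> (\<forall>\<^sub>F e in nhds 0. x + e *\<^sub>R v \<in> X)"
  shows "num_cells a b X (insert n I) = num_cells a b X I + num_cells a b (X \<inter> {x. a n \<bullet> x = b n}) I"
proof -
  define s where "s = positive_sides a b I"
  define Y where "Y = X \<inter> off_planes a b I"
  define A where "A = s ` {x\<in>Y. a n \<bullet> x < b n}"
  define B where "B = s ` {x\<in>Y. a n \<bullet> x > b n}"
  have s_sub: "s x \<subseteq> I" for x by (auto simp: s_def positive_sides_def)
  have "A \<subseteq> Pow I" "B \<subseteq> Pow I" using s_sub by (auto simp: A_def B_def)
  then have finAB: "finite A" "finite B" using fin by (auto intro: finite_subset)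
  have nAB: "n \<notin> \<sigma>" if "\<sigma> \<in> A \<union> B" for \<sigma>
    using that \<open>A \<subseteq> Pow I\<close> \<open>B \<subseteq> Pow I\<close> \<open>n \<notin> I\<close> by blast
  \<comment> \<open>A point of \<open>Y\<close> on the new hyperplane can be moved both ways along
    \<open>v\<close> without changing any old sign, so its sign vector occurs on both sides.\<close>
  have near: "\<exists>y\<in>Y. \<exists>z\<in>Y. s y = s x \<and> s z = s x \<and> a n \<bullet> y < b n \<and> a n \<bullet> z > b n"
    if x: "x \<in> Y" and xn: "a n \<bullet> x = b n" for x
  proof -
    obtain v where v: "a n \<bullet> v > 0" and ev: "\<forall>\<^sub>F e in nhds 0. x + e *\<^sub>R v \<in> X"
      using trans[of x] x xn by (auto simp: Y_def)
    have "((\<lambda>e. x + e *\<^sub>R v) \<longlongrightarrow> x + 0 *\<^sub>R v) (nhds 0)"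
      by (intro tendsto_intros filterlim_ident)
    then have "filterlim (\<lambda>e. x + e *\<^sub>R v) (nhds x) (nhds 0)" by simp
    moreover have "\<forall>\<^sub>F y in nhds x. y \<in> off_planes a b I \<and> s y = s x"
      using positive_sides_locally_constant[OF fin] x by (auto simp: Y_def s_def)
    ultimately have "\<forall>\<^sub>F e in nhds 0. x + e *\<^sub>R v \<in> off_planes a b I \<and> s (x + e *\<^sub>R v) = s x"
      by (rule eventually_compose_filterlim[rotated])
    then have "\<forall>\<^sub>F e in nhds 0. x + e *\<^sub>R v \<in> Y \<and> s (x + e *\<^sub>R v) = s x"
      using ev by eventually_elim (auto simp: Y_def)
    then obtain d where "d > 0" and d: "\<And>e. dist e 0 < d \<Longrightarrow> x + e *\<^sub>R v \<in> Y \<and> s (x + e *\<^sub>R v) = s x"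
      unfolding eventually_nhds_metric by blast
    have "x - (d / 2) *\<^sub>R v \<in> Y \<and> s (x - (d / 2) *\<^sub>R v) = s x \<and> a n \<bullet> (x - (d / 2) *\<^sub>R v) < b n"
      "x + (d / 2) *\<^sub>R v \<in> Y \<and> s (x + (d / 2) *\<^sub>R v) = s x \<and> a n \<bullet> (x + (d / 2) *\<^sub>R v) > b n"
      using d[of "- (d / 2)"] d[of "d / 2"] \<open>d > 0\<close> v xn
      by (auto simp: inner_add_right inner_diff_right)
    then show ?thesis by blast
  qed
  \<comment> \<open>The index \<open>n\<close> marks the positive side, so a sign vector in both
    \<open>A\<close> and \<open>B\<close> is counted twice.\<close>
  have "positive_sides a b (insert n I) ` (X \<inter> off_planes a b (insert n I)) = A \<union> insert n ` B"
  proof -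
    have "X \<inter> off_planes a b (insert n I) = {x\<in>Y. a n \<bullet> x < b n} \<union> {x\<in>Y. a n \<bullet> x > b n}"
      by (auto simp: Y_def off_planes_def)
    moreover have "positive_sides a b (insert n I) x = s x" if "a n \<bullet> x < b n" for x
      using that by (auto simp: positive_sides_def s_def)
    moreover have "positive_sides a b (insert n I) x = insert n (s x)" if "a n \<bullet> x > b n" for x
      using that by (auto simp: positive_sides_def s_def)
    ultimately show ?thesis
      by (simp add: A_def B_def image_Un image_image cong: image_cong_simp)
  qed
  then have "num_cells a b X (insert n I) = card (A \<union> insert n ` B)"
    by (simp add: num_cells_def)
  also have "\<dots> = card A + card (insert n ` B)"
    using finAB nAB by (intro card_Un_disjoint) auto
  also have "card (insert n ` B) = card B"
    using nAB by (intro card_image inj_onI) (metis Un_iff insert_ident)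
  \<comment> \<open>The union turns out to be the set of all old cells, the intersection the set of
    those cut by the new hyperplane.\<close>
  also have "card A + card B = card (A \<union> B) + card (A \<inter> B)"
    using finAB by (rule card_Un_Int)
  also have "A \<union> B = s ` Y"
  proof
    show "s ` Y \<subseteq> A \<union> B"
    proof (rule image_subsetI)
      fix x assume x: "x \<in> Y"
      consider "a n \<bullet> x < b n" | "a n \<bullet> x > b n" | "a n \<bullet> x = b n" by linarith
      then show "s x \<in> A \<union> B"
      proof cases
        case 3
        then obtain y where "y \<in> Y" "s y = s x" "a n \<bullet> y < b n" using near[OF x] by blast
        then have "s y \<in> A" unfolding A_def by blast
        then show ?thesis using \<open>s y = s x\<close> by simp
      qed (use x in \<open>auto simp: A_def B_def\<close>)
    qed
  qed (auto simp: A_def B_def)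
  also have "A \<inter> B = s ` (Y \<inter> {x. a n \<bullet> x = b n})"
  proof
    show "s ` (Y \<inter> {x. a n \<bullet> x = b n}) \<subseteq> A \<inter> B"
    proof (rule image_subsetI)
      fix x assume "x \<in> Y \<inter> {x. a n \<bullet> x = b n}"
      then obtain y z where "y \<in> Y" "z \<in> Y" "s y = s x" "s z = s x" "a n \<bullet> y < b n" "a n \<bullet> z > b n"
        using near[of x] by blast
      then show "s x \<in> A \<inter> B"
        unfolding A_def B_def by (metis (mono_tags, lifting) IntI imageI mem_Collect_eq)
    qed
    show "A \<inter> B \<subseteq> s ` (Y \<inter> {x. a n \<bullet> x = b n})"
    proof
      fix \<sigma> assume "\<sigma> \<in> A \<inter> B"
      then obtain y z where y: "y \<in> Y" "s y = \<sigma>" "a n \<bullet> y < b n" and z: "z \<in> Y" "s z = \<sigma>" "a n \<bullet> z > b n"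
        by (auto simp: A_def B_def)
      \<comment> \<open>The weight at which the segment from \<open>y\<close> to \<open>z\<close>
        crosses the new hyperplane.\<close>
      define u where "u = (b n - a n \<bullet> y) / (a n \<bullet> z - a n \<bullet> y)"
      define x where "x = (1 - u) *\<^sub>R y + u *\<^sub>R z"
      have u: "0 < u" "u < 1" using y z by (auto simp: u_def field_simps)
      have side: "a k \<bullet> x - b k = (1 - u) * (a k \<bullet> y - b k) + u * (a k \<bullet> z - b k)" for k
        by (simp add: x_def inner_add_right algebra_simps)
      \<comment> \<open>The points \<open>y\<close> and \<open>z\<close> lie strictly on the same
        side of every old hyperplane, hence so does \<open>x\<close> between them.\<close>
      have same: "a k \<bullet> x \<noteq> b k \<and> (b k < a k \<bullet> x \<longleftrightarrow> b k < a k \<bullet> y)" if "k \<in> I" for k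
      proof -
        have iff: "b k < a k \<bullet> y \<longleftrightarrow> b k < a k \<bullet> z"
          using y z that unfolding s_def positive_sides_def by blast
        have "a k \<bullet> y \<noteq> b k" "a k \<bullet> z \<noteq> b k"
          using y z that by (auto simp: Y_def off_planes_def)
        then consider "b k < a k \<bullet> y" "b k < a k \<bullet> z" | "b k > a k \<bullet> y" "b k > a k \<bullet> z"
          using iff by linarith
        then show ?thesis
        proof cases
          case 1
          then have "0 < (1 - u) * (a k \<bullet> y - b k) + u * (a k \<bullet> z - b k)"
            using u by (intro add_pos_pos mult_pos_pos) auto
          then show ?thesis using side[of k] 1 by linarith
        next
          case 2
          then have "(1 - u) * (a k \<bullet> y - b k) + u * (a k \<bullet> z - b k) < 0"
            using u by (intro add_neg_neg mult_pos_neg) auto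
          then show ?thesis using side[of k] 2 by linarith
        qed
      qed
      have "x \<in> X"
        using X y z u by (auto simp: x_def Y_def convex_alt)
      moreover have "a n \<bullet> x = b n"
        using y z by (simp add: x_def u_def inner_add_right divide_simps) (simp add: algebra_simps)
      moreover have "x \<in> off_planes a b I" "s x = \<sigma>"
        using same y unfolding s_def off_planes_def positive_sides_def by auto
      ultimately show "\<sigma> \<in> s ` (Y \<inter> {x. a n \<bullet> x = b n})"
        by (auto simp: Y_def)
    qed
  qed
  finally show ?thesis
    by (simp add: num_cells_def s_def Y_def Int_ac)
qed

section \<open>Connected components as cells\<close>

text \<open>Both images are quotients of \<open>S\<close> by the same equivalence relation. This
  lets sign vectors stand in for components.\<close>

lemma card_image_eq_card_image:
  assumes "\<And>x y. x \<in> S \<Longrightarrow> y \<in> S \<Longrightarrow> f x = f y \<longleftrightarrow> g x = g y"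
  shows "card (f ` S) = card (g ` S)"
proof -
  have "bij_betw (\<lambda>c. g (inv_into S f c)) (f ` S) (g ` S)"
  proof (rule bij_betwI')
    fix c d assume "c \<in> f ` S" "d \<in> f ` S"
    then show "g (inv_into S f c) = g (inv_into S f d) \<longleftrightarrow> c = d"
      using assms by (metis f_inv_into_f inv_into_into)
  next
    fix c assume "c \<in> g ` S"
    then show "\<exists>d\<in>f ` S. c = g (inv_into S f d)"
      using assms by (metis (no_types, opaque_lifting) f_inv_into_f image_iff inv_into_into)
  qed (auto simp: inv_into_into)
  then show ?thesis by (rule bij_betw_same_card)
qed

text \<open>A connected set that avoids a hyperplane stays on one side of it, by the intermediate
  value property. Conversely, the points with a given sign vector form an intersection of
  \<open>X\<close> with half-spaces, which is convex and so connected.\<close>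

lemma card_components_off_planes:
  fixes a :: "'i \<Rightarrow> 'a::real_inner"
  assumes X: "convex X"
  shows "card (components (X \<inter> off_planes a b I)) = num_cells a b X I"
proof -
  define S where "S = X \<inter> off_planes a b I"
  define s where "s = positive_sides a b I"
  have comp: "connected_component S x y \<longleftrightarrow> s x = s y" if "x \<in> S" "y \<in> S" for x y
  proof
    assume "connected_component S x y"
    then obtain T where T: "connected T" "T \<subseteq> S" "x \<in> T" "y \<in> T"
      unfolding connected_component_def by blast
    have "b k < a k \<bullet> x \<longleftrightarrow> b k < a k \<bullet> y" if "k \<in> I" for k
    proof -
      have "connected ((\<lambda>z. a k \<bullet> z) ` T)"
        by (intro connected_continuous_image continuous_intros T)
      moreover have "b k \<notin> (\<lambda>z. a k \<bullet> z) ` T"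
        using T(2) that unfolding S_def off_planes_def by force
      moreover have "a k \<bullet> x \<in> (\<lambda>z. a k \<bullet> z) ` T" "a k \<bullet> y \<in> (\<lambda>z. a k \<bullet> z) ` T"
        using T by auto
      ultimately show ?thesis
        by (meson connectedD_interval less_imp_le not_le)
    qed
    then show "s x = s y" by (auto simp: s_def positive_sides_def)
  next
    assume eq: "s x = s y"
    have "convex {z\<in>S. s z = s x}"
    proof -
      have side: "(a k \<bullet> z \<noteq> b k \<and> (b k < a k \<bullet> z \<longleftrightarrow> b k < a k \<bullet> x)) \<longleftrightarrow>
          z \<in> (if b k < a k \<bullet> x then {z. a k \<bullet> z > b k} else {z. a k \<bullet> z < b k})" for k z
        by auto
      have "s z = s x \<longleftrightarrow> (\<forall>k\<in>I. b k < a k \<bullet> z \<longleftrightarrow> b k < a k \<bullet> x)" for z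
        by (auto simp: s_def positive_sides_def)
      then have "{z\<in>S. s z = s x} =
          X \<inter> {z. \<forall>k\<in>I. a k \<bullet> z \<noteq> b k \<and> (b k < a k \<bullet> z \<longleftrightarrow> b k < a k \<bullet> x)}"
        by (auto simp: S_def off_planes_def)
      also have "{z. \<forall>k\<in>I. a k \<bullet> z \<noteq> b k \<and> (b k < a k \<bullet> z \<longleftrightarrow> b k < a k \<bullet> x)} =
          (\<Inter>k\<in>I. if b k < a k \<bullet> x then {z. a k \<bullet> z > b k} else {z. a k \<bullet> z < b k})"
        unfolding side by blast
      also have "convex (X \<inter> (\<Inter>k\<in>I.
          if b k < a k \<bullet> x then {z. a k \<bullet> z > b k} else {z. a k \<bullet> z < b k}))"
        using X by (intro convex_Int convex_INT) (auto intro: convex_halfspace_lt convex_halfspace_gt)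
      finally show ?thesis .
    qed
    then show "connected_component S x y"
      unfolding connected_component_def using that eq
      by (intro exI[of _ "{z\<in>S. s z = s x}"]) (auto intro: convex_connected)
  qed
  have "components S = connected_component_set S ` S"
    by (auto simp: components_def)
  moreover have "connected_component_set S x = connected_component_set S y \<longleftrightarrow> s x = s y"
    if "x \<in> S" "y \<in> S" for x y
    using comp[OF that] that by (metis connected_component_eq_eq)
  ultimately have "card (components S) = card (s ` S)"
    using card_image_eq_card_image[of S "connected_component_set S" s] by simp
  then show ?thesis by (simp add: S_def s_def num_cells_def)
qed

section \<open>The chords of the trajectory\<close>

text \<open>The mean of the polar angles of the two endpoints of path \<open>n\<close>; the chord is
  perpendicular to this direction.\<close>

definition chord_angle :: "nat \<Rightarrow> nat \<Rightarrow> nat \<Rightarrow> real" where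
  "chord_angle p q n = pi * real p * (2 * real n - 1) / real q"

definition chord_normal :: "nat \<Rightarrow> nat \<Rightarrow> nat \<Rightarrow> real \<times> real" where
  "chord_normal p q n = (cos (chord_angle p q n), sin (chord_angle p q n))"

definition chord_dir :: "nat \<Rightarrow> nat \<Rightarrow> nat \<Rightarrow> real \<times> real" where
  "chord_dir p q n = (- sin (chord_angle p q n), cos (chord_angle p q n))"

text \<open>All chords are tangent to the circle of this radius about the origin.\<close>

definition inradius :: "real \<Rightarrow> nat \<Rightarrow> nat \<Rightarrow> real" where
  "inradius R p q = R * cos (pi * real p / real q)"

definition half_chord :: "real \<Rightarrow> nat \<Rightarrow> nat \<Rightarrow> real" where
  "half_chord R p q = R * sin (pi * real p / real q)"

abbreviation chord_line :: "real \<Rightarrow> nat \<Rightarrow> nat \<Rightarrow> nat \<Rightarrow> (real \<times> real) set" where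
  "chord_line R p q n \<equiv> {z. chord_normal p q n \<bullet> z = inradius R p q}"

text \<open>Here \<open>t\<close> is the signed distance from the foot of the perpendicular from the
  origin; this foot is the midpoint of the chord.\<close>

definition chord_point :: "real \<Rightarrow> nat \<Rightarrow> nat \<Rightarrow> nat \<Rightarrow> real \<Rightarrow> real \<times> real" where
  "chord_point R p q n t = inradius R p q *\<^sub>R chord_normal p q n + t *\<^sub>R chord_dir p q n"

lemma inner_chord_normal [simp]: "chord_normal p q n \<bullet> chord_normal p q n = 1"
  by (simp add: chord_normal_def flip: power2_eq_square)

lemma inner_chord_dir [simp]: "chord_dir p q n \<bullet> chord_dir p q n = 1"
  by (simp add: chord_dir_def flip: power2_eq_square)

lemma inner_chord_normal_dir [simp]: "chord_normal p q n \<bullet> chord_dir p q n = 0"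
  by (simp add: chord_normal_def chord_dir_def)

lemma chord_basis: "z = (chord_normal p q n \<bullet> z) *\<^sub>R chord_normal p q n + (chord_dir p q n \<bullet> z) *\<^sub>R chord_dir p q n"
proof -
  define c s where "c = cos (chord_angle p q n)" and "s = sin (chord_angle p q n)"
  have cs: "c * c + s * s = 1" by (simp add: c_def s_def flip: power2_eq_square)
  obtain x y where z: "z = (x, y)" by (cases z)
  have "x = (c * x + s * y) * c - (c * y - s * x) * s" "y = (c * x + s * y) * s + (c * y - s * x) * c"
    using cs by algebra+
  then show ?thesis
    by (simp add: z chord_normal_def chord_dir_def flip: c_def s_def)
qed

lemma chord_line_eq_range: "chord_line R p q n = range (chord_point R p q n)"
proof
  show "chord_line R p q n \<subseteq> range (chord_point R p q n)"
  proof
    fix z assume "z \<in> chord_line R p q n"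
    then have "z = chord_point R p q n (chord_dir p q n \<bullet> z)"
      using chord_basis[of z p q n] by (simp add: chord_point_def)
    then show "z \<in> range (chord_point R p q n)" by blast
  qed
qed (auto simp: chord_point_def inner_add_right)

lemma power2_less_iff_abs_less: "x\<^sup>2 < y\<^sup>2 \<longleftrightarrow> \<bar>x\<bar> < \<bar>y\<bar>" for x y :: real
  using abs_le_square_iff[of y x] by linarith

text \<open>Pythagoras, used twice: for the point at \<open>t\<close>, and for the right triangle
  with legs \<open>inradius\<close> and \<open>half_chord\<close> and hypotenuse
  \<open>R\<close>.\<close>

lemma norm_chord_point_less_iff:
  assumes "R > 0" and "half_chord R p q > 0"
  shows "norm (chord_point R p q n t) < R \<longleftrightarrow> \<bar>t\<bar> < half_chord R p q"
proof -
  have "chord_point R p q n t \<bullet> chord_point R p q n t = (inradius R p q)\<^sup>2 + t\<^sup>2"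
    by (simp add: chord_point_def inner_add_left inner_add_right inner_commute[of "chord_dir p q n" "chord_normal p q n"]
        power2_eq_square)
  moreover have "(inradius R p q)\<^sup>2 + (half_chord R p q)\<^sup>2 = R\<^sup>2"
    by (simp add: inradius_def half_chord_def power_mult_distrib flip: distrib_left)
  moreover have "norm (chord_point R p q n t) < R \<longleftrightarrow> (norm (chord_point R p q n t))\<^sup>2 < R\<^sup>2"
    using assms by (simp add: power2_less_iff_abs_less)
  moreover have "\<bar>t\<bar> < half_chord R p q \<longleftrightarrow> t\<^sup>2 < (half_chord R p q)\<^sup>2"
    using assms by (simp add: power2_less_iff_abs_less)
  ultimately show ?thesis
    using power2_norm_eq_inner[of "chord_point R p q n t"] by argo
qed

text \<open>The endpoints have the polar angles \<open>chord_angle p q n\<close> minus and plus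
  \<open>pi * p / q\<close>, so the addition theorems apply.\<close>

lemma straight_path_eq:
  assumes "q > 0"
  shows "straight_path R p q n =
    closed_segment (chord_point R p q n (- half_chord R p q)) (chord_point R p q n (half_chord R p q))"
proof -
  define \<mu> \<delta> where "\<mu> = chord_angle p q n" and "\<delta> = pi * real p / real q"
  have "2 * pi * of_int (int p * (int n - 1)) / of_nat q = \<mu> - \<delta>"
    "2 * pi * of_int (int p * int n) / of_nat q = \<mu> + \<delta>"
    using assms by (simp_all add: \<mu>_def \<delta>_def chord_angle_def field_simps)
  then show ?thesis
    unfolding straight_path_def boundary_point_def
    by (simp only:)
      (simp add: chord_point_def chord_normal_def chord_dir_def inradius_def half_chord_def
        cos_add cos_diff sin_add sin_diff algebra_simps flip: \<mu>_def \<delta>_def)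
qed

text \<open>The line leaves the open disk exactly at the two endpoints of the path. Hence removing
  the paths and removing the full lines leave the same set.\<close>

lemma ball_Int_straight_path:
  assumes "R > 0" "q > 0" and h: "half_chord R p q > 0"
  shows "ball (0, 0) R \<inter> straight_path R p q n = ball (0, 0) R \<inter> chord_line R p q n"
proof
  define h where "h = half_chord R p q"
  have aff: "(1 - u) *\<^sub>R chord_point R p q n (- h) + u *\<^sub>R chord_point R p q n h
      = chord_point R p q n ((2 * u - 1) * h)" for u
    by (simp add: chord_point_def prod_eq_iff algebra_simps)
  show "ball (0, 0) R \<inter> straight_path R p q n \<subseteq> ball (0, 0) R \<inter> chord_line R p q n"
    unfolding straight_path_eq[OF \<open>q > 0\<close>] chord_line_eq_range closed_segment_def
    using aff by (auto simp flip: h_def)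
  show "ball (0, 0) R \<inter> chord_line R p q n \<subseteq> ball (0, 0) R \<inter> straight_path R p q n"
  proof
    fix z assume z: "z \<in> ball (0, 0) R \<inter> chord_line R p q n"
    then obtain t where t: "z = chord_point R p q n t"
      unfolding chord_line_eq_range by blast
    have "norm (chord_point R p q n t) < R"
      using z t by (simp add: zero_prod_def[symmetric])
    then have th: "\<bar>t\<bar> < h"
      using norm_chord_point_less_iff assms by (simp add: h_def)
    \<comment> \<open>The solution of \<open>(2 * u - 1) * h = t\<close>, which inverts the change
      of parameter in \<open>aff\<close>.\<close>
    define u where "u = (1 + t / h) / 2"
    have "0 \<le> u" "u \<le> 1" using th by (auto simp: u_def field_simps)
    moreover have "(2 * u - 1) * h = t" using th by (simp add: u_def field_simps)
    then have "z = (1 - u) *\<^sub>R chord_point R p q n (- h) + u *\<^sub>R chord_point R p q n h"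
      unfolding aff t by simp
    ultimately have "z \<in> straight_path R p q n"
      unfolding straight_path_eq[OF \<open>q > 0\<close>] closed_segment_def h_def by blast
    then show "z \<in> ball (0, 0) R \<inter> straight_path R p q n" using z by blast
  qed
qed

lemma num_regions_eq_num_cells:
  assumes "R > 0" "q > 0" "half_chord R p q > 0"
  shows "num_regions R p q n = num_cells (chord_normal p q) (\<lambda>_. inradius R p q) (ball 0 R) {1..n}"
proof -
  have "ball (0, 0) R - (\<Union>k\<in>{1..n}. straight_path R p q k)
      = ball 0 R \<inter> off_planes (chord_normal p q) (\<lambda>_. inradius R p q) {1..n}"
    using ball_Int_straight_path[OF assms] unfolding off_planes_def zero_prod_def by blast
  then show ?thesis
    unfolding num_regions_def by (simp add: card_components_off_planes)
qed

section \<open>Crossings of two chords\<close>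

text \<open>The normals enclose the angle \<open>2 * \<theta>\<close>, and the double-angle formulas
  split off a factor \<open>sin \<theta>\<close>. Where it is nonzero, meeting line \<open>k\<close>
  is an equation affine in \<open>t\<close>.\<close>

lemma chord_normal_inner_chord_point:
  assumes "\<theta> = (chord_angle p q n - chord_angle p q k) / 2"
  shows "chord_normal p q k \<bullet> chord_point R p q n t - inradius R p q
    = - (2 * sin \<theta>) * (inradius R p q * sin \<theta> + t * cos \<theta>)"
proof -
  define \<mu> \<nu> where "\<mu> = chord_angle p q n" and "\<nu> = chord_angle p q k"
  have \<theta>: "\<mu> - \<nu> = 2 * \<theta>" using assms by (simp add: \<mu>_def \<nu>_def)
  have "cos \<nu> * cos \<mu> + sin \<nu> * sin \<mu> = cos (2 * \<theta>)"
    unfolding \<theta>[symmetric] cos_diff by simp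
  moreover have "sin \<nu> * cos \<mu> - cos \<nu> * sin \<mu> = - sin (2 * \<theta>)"
    unfolding \<theta>[symmetric] sin_diff by simp
  moreover have "chord_normal p q k \<bullet> chord_point R p q n t
    = inradius R p q * (cos \<nu> * cos \<mu> + sin \<nu> * sin \<mu>) + t * (sin \<nu> * cos \<mu> - cos \<nu> * sin \<mu>)"
    by (simp add: chord_point_def chord_normal_def chord_dir_def algebra_simps flip: \<mu>_def \<nu>_def)
  ultimately show ?thesis
    by (simp only: cos_double_sin sin_double) (simp add: power2_eq_square algebra_simps)
qed

text \<open>With \<open>\<delta> = pi * p / q\<close>, the lines meet at
  \<open>t = - R * cos \<delta> * tan \<theta>\<close>, while the chord extends to
  \<open>R * sin \<delta>\<close> on either side. So they cross in the disk iff the absolute value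
  of \<open>tan \<theta>\<close> is below \<open>tan \<delta>\<close>.\<close>

lemma crosses_iff:
  assumes "R > 0" and \<delta>: "0 < pi * real p / real q" "pi * real p / real q < pi / 2"
    and \<theta>: "\<theta> = (chord_angle p q n - chord_angle p q k) / 2" and "sin \<theta> \<noteq> 0"
  shows "ball 0 R \<inter> chord_line R p q n \<inter> chord_line R p q k \<noteq> {} \<longleftrightarrow> cos (pi * real p / real q) < \<bar>cos \<theta>\<bar>"
proof -
  define \<delta> \<rho> h where "\<delta> = pi * real p / real q" and "\<rho> = inradius R p q" and "h = half_chord R p q"
  have pos: "cos \<delta> > 0" "sin \<delta> > 0"
    using \<delta> cos_gt_zero[of \<delta>] sin_gt_zero[of \<delta>] pi_gt_zero unfolding \<delta>_def by linarith+
  then have h: "h > 0" using \<open>R > 0\<close> by (simp add: h_def half_chord_def flip: \<delta>_def)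
  have "ball 0 R \<inter> chord_line R p q n \<inter> chord_line R p q k \<noteq> {} \<longleftrightarrow>
      (\<exists>t. \<bar>t\<bar> < h \<and> \<rho> * sin \<theta> + t * cos \<theta> = 0)"
  proof -
    have "ball 0 R \<inter> chord_line R p q n \<inter> chord_line R p q k
        = chord_point R p q n ` {t. norm (chord_point R p q n t) < R \<and>
            chord_normal p q k \<bullet> chord_point R p q n t - \<rho> = 0}"
      unfolding chord_line_eq_range[of p q n R] by (auto simp: \<rho>_def)
    also have "\<dots> = chord_point R p q n ` {t. \<bar>t\<bar> < h \<and> \<rho> * sin \<theta> + t * cos \<theta> = 0}"
      unfolding \<rho>_def h_def chord_normal_inner_chord_point[OF \<theta>]
      using \<open>sin \<theta> \<noteq> 0\<close> norm_chord_point_less_iff[OF \<open>R > 0\<close>] h by (simp add: h_def)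
    finally show ?thesis by auto
  qed
  also have "\<dots> \<longleftrightarrow> cos \<delta> < \<bar>cos \<theta>\<bar>"
  proof (cases "cos \<theta> = 0")
    \<comment> \<open>The normals are opposite and the lines parallel and distinct, so both sides
      are false.\<close>
    case True
    then show ?thesis
      using pos \<open>R > 0\<close> \<open>sin \<theta> \<noteq> 0\<close> by (simp add: \<rho>_def inradius_def flip: \<delta>_def)
  next
    case False
    have "(\<exists>t. \<bar>t\<bar> < h \<and> \<rho> * sin \<theta> + t * cos \<theta> = 0) \<longleftrightarrow> \<bar>\<rho> * sin \<theta> / cos \<theta>\<bar> < h"
    proof
      assume "\<exists>t. \<bar>t\<bar> < h \<and> \<rho> * sin \<theta> + t * cos \<theta> = 0"
      then obtain t where "\<bar>t\<bar> < h" "\<rho> * sin \<theta> + t * cos \<theta> = 0" by blast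
      moreover from this have "\<rho> * sin \<theta> / cos \<theta> = - t"
        using False by (simp add: field_simps)
      ultimately show "\<bar>\<rho> * sin \<theta> / cos \<theta>\<bar> < h" by simp
    qed (use False in \<open>auto intro!: exI[of _ "- (\<rho> * sin \<theta> / cos \<theta>)"]\<close>)
    also have "\<dots> \<longleftrightarrow> cos \<delta> * \<bar>sin \<theta>\<bar> < sin \<delta> * \<bar>cos \<theta>\<bar>"
      using False pos \<open>R > 0\<close>
      by (simp add: \<rho>_def h_def inradius_def half_chord_def abs_mult field_simps flip: \<delta>_def)
    also have "\<dots> \<longleftrightarrow> (cos \<delta> * \<bar>sin \<theta>\<bar>)\<^sup>2 < (sin \<delta> * \<bar>cos \<theta>\<bar>)\<^sup>2"
      using pos by (simp add: power2_less_iff_abs_less abs_mult)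
    \<comment> \<open>Once squared sines are written as 1 minus squared cosines, the mixed products
      cancel.\<close>
    also have "\<dots> \<longleftrightarrow> (cos \<delta>)\<^sup>2 < \<bar>cos \<theta>\<bar>\<^sup>2"
      by (simp add: power_mult_distrib sin_squared_eq algebra_simps)
    also have "\<dots> \<longleftrightarrow> cos \<delta> < \<bar>cos \<theta>\<bar>"
      using pos by (simp add: power2_less_iff_abs_less abs_mult)
    finally show ?thesis .
  qed
  finally show ?thesis by (simp add: \<delta>_def)
qed

text \<open>A zero would make \<open>q\<close> divide \<open>p * i\<close> and so, by coprimality,
  \<open>i\<close>. With \<open>i\<close> a difference of path numbers, this keeps the lines of
  different paths apart.\<close>

lemma sin_ne_0_if_not_multiple:
  assumes "coprime p q" "q > 0" and i: "i \<noteq> 0" "\<bar>i\<bar> < int q"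
  shows "sin (pi * real p * of_int i / real q) \<noteq> 0"
proof
  assume "sin (pi * real p * of_int i / real q) = 0"
  then obtain j where "pi * real p * of_int i / real q = of_int j * pi"
    using sin_zero_iff_int2 by blast
  then have "real_of_int (int p * i) = real_of_int (j * int q)"
    using \<open>q > 0\<close> by (simp add: field_simps)
  then have "int p * i = j * int q" by (simp only: of_int_eq_iff)
  then have "int q dvd int p * i" by simp
  then have "int q dvd i"
    using \<open>coprime p q\<close> by (simp add: coprime_dvd_mult_right_iff coprime_commute)
  then show False
    using i zdvd_not_zless[of "\<bar>i\<bar>" "int q"] by simp
qed

lemma chord_angle_diff: "(chord_angle p q n - chord_angle p q k) / 2 = pi * real p * of_int (int n - int k) / real q"
  by (cases "q = 0") (simp_all add: chord_angle_def field_simps)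

lemma half_angle_bounds:
  assumes "p > 0" "2 * p < q"
  shows "0 < pi * real p / real q" "pi * real p / real q < pi / 2"
proof -
  have "2 * real p < real q" using assms by linarith
  then show "pi * real p / real q < pi / 2" using assms by (simp add: field_simps)
qed (use assms in auto)

lemma inradius_pos: "R > 0 \<Longrightarrow> p > 0 \<Longrightarrow> 2 * p < q \<Longrightarrow> inradius R p q > 0"
  unfolding inradius_def using half_angle_bounds[of p q] by (intro mult_pos_pos cos_gt_zero) auto

lemma half_chord_pos:
  assumes "R > 0" "p > 0" "2 * p < q"
  shows "half_chord R p q > 0"
proof -
  have "pi * real p / real q < pi"
    using half_angle_bounds[OF assms(2,3)] pi_gt_zero by linarith
  then show ?thesis
    unfolding half_chord_def using half_angle_bounds[OF assms(2,3)] \<open>R > 0\<close>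
    by (intro mult_pos_pos sin_gt_zero)
qed

section \<open>Pieces of a new chord\<close>

text \<open>Induction on the earlier chords, with \<open>num_cells_insert\<close> applied to the
  chord \<open>C\<close> in place of the disk. A crossing chord adds one piece because the crossing
  point is a single cell that no other chord removes.\<close>

lemma num_cells_chord:
  assumes "R > 0" "p > 0" "2 * p < q" "coprime p q" "n \<le> q" "0 < n"
    and J: "J \<subseteq> {1..<n}"
  defines "C \<equiv> ball 0 R \<inter> chord_line R p q n"
  shows "num_cells (chord_normal p q) (\<lambda>_. inradius R p q) C J
    = 1 + card {k\<in>J. C \<inter> chord_line R p q k \<noteq> {}}"
proof -
  define \<rho> where "\<rho> = inradius R p q"
  define \<theta> where "\<theta> k = pi * real p * of_int (int n - int k) / real q" for k
  have "q > 0" using assms by simp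
  have pos: "\<rho> > 0" "half_chord R p q > 0"
    using assms inradius_pos half_chord_pos by (auto simp: \<rho>_def)
  have line: "chord_normal p q k \<bullet> chord_point R p q n t - \<rho> = - (2 * sin (\<theta> k)) * (\<rho> * sin (\<theta> k) + t * cos (\<theta> k))" for k t
    unfolding \<rho>_def by (rule chord_normal_inner_chord_point) (simp add: \<theta>_def chord_angle_diff)
  have sin: "sin (\<theta> k) \<noteq> 0" if "k \<in> {1..<n}" for k
    unfolding \<theta>_def using that \<open>n \<le> q\<close> assms by (intro sin_ne_0_if_not_multiple) auto
  have meet: "chord_point R p q n t \<in> chord_line R p q k \<longleftrightarrow> \<rho> * sin (\<theta> k) + t * cos (\<theta> k) = 0"
    if "k \<in> {1..<n}" for k t
    using line[of k t] sin[OF that] by (auto simp: \<rho>_def)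
  have cos: "cos (\<theta> k) \<noteq> 0" if "k \<in> {1..<n}" "\<rho> * sin (\<theta> k) + t * cos (\<theta> k) = 0" for k t
    using that sin[of k] pos by auto
  have "finite J" using J finite_subset by blast
  then show ?thesis
    using J
  proof (induction J rule: finite_induct)
    case empty
    \<comment> \<open>The midpoint shows that the uncut chord is nonempty and hence one
      piece.\<close>
    have "chord_point R p q n 0 \<in> C"
      using norm_chord_point_less_iff[OF \<open>R > 0\<close> pos(2), of n 0] pos
      unfolding C_def chord_line_eq_range by simp
    then have "positive_sides (chord_normal p q) (\<lambda>_. inradius R p q) {} ` C = {{}}"
      by (auto simp: positive_sides_def)
    then show ?case by (simp add: num_cells_def off_planes_def)
  next
    case (insert k J)
    have k: "k \<in> {1..<n}" using insert by blast
    have "num_cells (chord_normal p q) (\<lambda>_. inradius R p q) C (insert k J)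
      = num_cells (chord_normal p q) (\<lambda>_. inradius R p q) C J
        + num_cells (chord_normal p q) (\<lambda>_. inradius R p q) (C \<inter> chord_line R p q k) J"
    proof (rule num_cells_insert)
      show "convex C" unfolding C_def by (intro convex_Int convex_ball convex_hyperplane)
      fix x assume x: "x \<in> C" "chord_normal p q k \<bullet> x = inradius R p q"
      then obtain t where t: "x = chord_point R p q n t"
        unfolding C_def chord_line_eq_range by blast
      with x meet[OF k, of t] have "\<rho> * sin (\<theta> k) + t * cos (\<theta> k) = 0" by simp
      then have "cos (\<theta> k) \<noteq> 0" using cos k by blast
      \<comment> \<open>The slope along chord \<open>n\<close> of the linear function that defines
        line \<open>k\<close>. It is nonzero at a crossing of distinct lines, and scaling the
        direction by \<open>c\<close> makes the slope the positive number
        \<open>c * c\<close>.\<close>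
      define c where "c = chord_normal p q k \<bullet> chord_dir p q n"
      have "c = chord_normal p q k \<bullet> chord_point R p q n (t + 1) - chord_normal p q k \<bullet> chord_point R p q n t"
        by (simp add: c_def chord_point_def inner_add_right algebra_simps)
      also have "\<dots> = - (2 * sin (\<theta> k)) * cos (\<theta> k)"
        using line[of k t] line[of k "t + 1"] by (simp add: algebra_simps)
      finally have "c \<noteq> 0" using sin[OF k] \<open>cos (\<theta> k) \<noteq> 0\<close> by simp
      define v where "v = c *\<^sub>R chord_dir p q n"
      have "chord_normal p q k \<bullet> v = c * c" by (simp add: v_def c_def)
      then have "chord_normal p q k \<bullet> v > 0" using \<open>c \<noteq> 0\<close> by (metis not_real_square_gt_zero)
      moreover have "\<forall>\<^sub>F e in nhds 0. x + e *\<^sub>R v \<in> C"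
      proof -
        have "((\<lambda>e. x + e *\<^sub>R v) \<longlongrightarrow> x + 0 *\<^sub>R v) (nhds 0)"
          by (intro tendsto_intros filterlim_ident)
        then have "\<forall>\<^sub>F e in nhds 0. x + e *\<^sub>R v \<in> ball 0 R"
          by (rule topological_tendstoD) (use x in \<open>auto simp: C_def\<close>)
        moreover have "chord_normal p q n \<bullet> (x + e *\<^sub>R v) = inradius R p q" for e
          using x by (simp add: C_def v_def inner_add_right)
        ultimately show ?thesis by (simp add: C_def)
      qed
      ultimately show "\<exists>v. chord_normal p q k \<bullet> v > 0 \<and> (\<forall>\<^sub>F e in nhds 0. x + e *\<^sub>R v \<in> C)"
        by blast
    qed (use insert in auto)
    also have "num_cells (chord_normal p q) (\<lambda>_. inradius R p q) (C \<inter> chord_line R p q k) J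
      = (if C \<inter> chord_line R p q k \<noteq> {} then 1 else 0)"
    proof (cases "C \<inter> chord_line R p q k = {}")
      case True
      then show ?thesis by (simp add: num_cells_def)
    next
      case False
      then obtain t where t: "chord_point R p q n t \<in> C \<inter> chord_line R p q k"
        unfolding C_def chord_line_eq_range[of p q n R] by blast
      then have tk: "\<rho> * sin (\<theta> k) + t * cos (\<theta> k) = 0" using meet[OF k] by blast
      have "C \<inter> chord_line R p q k \<subseteq> {chord_point R p q n t}"
      proof
        fix x assume x: "x \<in> C \<inter> chord_line R p q k"
        then obtain u where u: "x = chord_point R p q n u"
          unfolding C_def chord_line_eq_range[of p q n R] by blast
        then have "\<rho> * sin (\<theta> k) + u * cos (\<theta> k) = 0" using meet[OF k] x by blast
        then have "u * cos (\<theta> k) = t * cos (\<theta> k)" using tk by linarith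
        then show "x \<in> {chord_point R p q n t}" using u cos[OF k tk] by simp
      qed
      then have single: "C \<inter> chord_line R p q k = {chord_point R p q n t}" using t by blast
      \<comment> \<open>There is no triple point: eliminating \<open>t\<close> from the equations
        for \<open>j\<close> and \<open>k\<close> leaves
        \<open>\<rho> * sin (\<theta> j - \<theta> k) = 0\<close>, which coprimality
        excludes.\<close>
      have "chord_point R p q n t \<notin> chord_line R p q j" if "j \<in> J" for j
      proof
        have j: "j \<in> {1..<n}" "j \<noteq> k" using that insert by auto
        assume "chord_point R p q n t \<in> chord_line R p q j"
        then have "\<rho> * sin (\<theta> j) + t * cos (\<theta> j) = 0" using meet[OF j(1)] by blast
        with tk have "\<rho> * (sin (\<theta> j) * cos (\<theta> k) - cos (\<theta> j) * sin (\<theta> k)) = 0"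
          by algebra
        then have "sin (\<theta> j - \<theta> k) = 0" using pos by (simp add: sin_diff)
        moreover have "\<theta> j - \<theta> k = pi * real p * of_int (int k - int j) / real q"
          by (simp add: \<theta>_def algebra_simps flip: diff_divide_distrib)
        moreover have "sin (pi * real p * of_int (int k - int j) / real q) \<noteq> 0"
          using \<open>coprime p q\<close> \<open>q > 0\<close> \<open>n \<le> q\<close> j k by (intro sin_ne_0_if_not_multiple) auto
        ultimately show False by simp
      qed
      then have "chord_point R p q n t \<in> off_planes (chord_normal p q) (\<lambda>_. inradius R p q) J"
        by (auto simp: off_planes_def)
      then show ?thesis unfolding single by (simp add: num_cells_def)
    qed
    also have "num_cells (chord_normal p q) (\<lambda>_. inradius R p q) C J = 1 + card {j\<in>J. C \<inter> chord_line R p q j \<noteq> {}}"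
      using insert by simp
    also have "{j\<in>insert k J. C \<inter> chord_line R p q j \<noteq> {}}
      = (if C \<inter> chord_line R p q k \<noteq> {} then insert k {j\<in>J. C \<inter> chord_line R p q j \<noteq> {}}
         else {j\<in>J. C \<inter> chord_line R p q j \<noteq> {}})"
      by auto
    ultimately show ?case using insert.hyps by simp
  qed
qed

section \<open>Counting crossings by residues\<close>

text \<open>The absolute value of the cosine has period \<open>pi\<close>, so only the residue
  \<open>s\<close> of \<open>p * d\<close> matters. The cosine decreases from 0 to
  \<open>pi\<close>: the first alternative compares with \<open>s\<close>, the second, for the
  negated cosine, with \<open>q - s\<close>.\<close>

lemma cos_less_abs_cos_iff:
  assumes "0 < p" "p < q"
  shows "cos (pi * real p / real q) < \<bar>cos (pi * real p * real d / real q)\<bar>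
    \<longleftrightarrow> p * d mod q < p \<or> q < p * d mod q + p"
proof -
  define a s where "a = p * d div q" and "s = p * d mod q"
  have "q > 0" using assms by simp
  then have "s < q" by (simp add: s_def)
  have "real p * real d = real q * real a + real s"
    by (metis a_def s_def mult_div_mod_eq of_nat_add of_nat_mult)
  then have "pi * real p * real d / real q = real a * pi + pi * real s / real q"
    using \<open>q > 0\<close> by (simp add: field_simps)
  then have "\<bar>cos (pi * real p * real d / real q)\<bar> = \<bar>cos (pi * real s / real q)\<bar>"
    by (simp add: cos_add abs_mult)
  moreover have "- cos (pi * real s / real q) = cos (pi * real (q - s) / real q)"
  proof -
    have "pi * real (q - s) / real q = pi - pi * real s / real q"
      using \<open>s < q\<close> by (simp add: of_nat_diff field_simps)
    then show ?thesis by simp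
  qed
  moreover have less: "cos (pi * real p / real q) < cos (pi * real t / real q) \<longleftrightarrow> t < p" if "t \<le> q" for t
    using that assms by (subst cos_mono_less_eq) (auto simp: field_simps)
  moreover have "x < \<bar>y\<bar> \<longleftrightarrow> x < y \<or> x < - y" for x y :: real
    by linarith
  ultimately have "cos (pi * real p / real q) < \<bar>cos (pi * real p * real d / real q)\<bar>
    \<longleftrightarrow> s < p \<or> q - s < p"
    using less[of s] less[of "q - s"] \<open>s < q\<close> by simp
  then show ?thesis
    using \<open>s < q\<close> by (auto simp: s_def)
qed

lemma num_regions_0:
  assumes "R > 0" "p > 0" "2 * p < q"
  shows "num_regions R p q 0 = 1"
proof -
  have "positive_sides (chord_normal p q) (\<lambda>_. inradius R p q) {} ` ball 0 R = {{}}"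
    using \<open>R > 0\<close> by (auto simp: positive_sides_def image_def intro!: exI[of _ 0])
  then show ?thesis
    using assms half_chord_pos by (simp add: num_regions_eq_num_cells num_cells_def off_planes_def)
qed

text \<open>The disk is open, so the normal of the new line itself serves as transversal vector.
  Crossing depends only on the distance \<open>d = Suc n - k\<close> of the path numbers, and this
  substitution is an involution of \<open>{1..n}\<close>.\<close>

lemma num_regions_Suc_crossings:
  assumes "R > 0" "p > 0" "2 * p < q" "coprime p q" "n < q"
  shows "num_regions R p q (Suc n)
    = num_regions R p q n + 1 + card {d\<in>{1..n}. p * d mod q < p \<or> q < p * d mod q + p}"
proof -
  have "q > 0" using assms by simp
  note regions = num_regions_eq_num_cells[OF \<open>R > 0\<close> \<open>q > 0\<close> half_chord_pos[OF assms(1-3)]]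
  have "{1..Suc n} = insert (Suc n) {1..n}" by auto
  then have "num_regions R p q (Suc n) = num_regions R p q n +
      num_cells (chord_normal p q) (\<lambda>_. inradius R p q) (ball 0 R \<inter> chord_line R p q (Suc n)) {1..n}"
    unfolding regions
  proof (simp only:, intro num_cells_insert)
    fix x assume x: "x \<in> ball (0 :: real \<times> real) R"
    have "((\<lambda>e. x + e *\<^sub>R chord_normal p q (Suc n)) \<longlongrightarrow> x + 0 *\<^sub>R chord_normal p q (Suc n)) (nhds 0)"
      by (intro tendsto_intros filterlim_ident)
    then have "\<forall>\<^sub>F e in nhds 0. x + e *\<^sub>R chord_normal p q (Suc n) \<in> ball 0 R"
      by (rule topological_tendstoD) (use x in auto)
    then show "\<exists>v. chord_normal p q (Suc n) \<bullet> v > 0 \<and> (\<forall>\<^sub>F e in nhds 0. x + e *\<^sub>R v \<in> ball 0 R)"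
      by (intro exI[of _ "chord_normal p q (Suc n)"]) simp
  qed auto
  also have "num_cells (chord_normal p q) (\<lambda>_. inradius R p q) (ball 0 R \<inter> chord_line R p q (Suc n)) {1..n}
      = 1 + card {k\<in>{1..n}. ball 0 R \<inter> chord_line R p q (Suc n) \<inter> chord_line R p q k \<noteq> {}}"
    using assms by (intro num_cells_chord) auto
  also have "{k\<in>{1..n}. ball 0 R \<inter> chord_line R p q (Suc n) \<inter> chord_line R p q k \<noteq> {}}
      = {k\<in>{1..n}. p * (Suc n - k) mod q < p \<or> q < p * (Suc n - k) mod q + p}"
  proof (intro Collect_cong conj_cong refl)
    fix k assume k: "k \<in> {1..n}"
    define \<theta> where "\<theta> = (chord_angle p q (Suc n) - chord_angle p q k) / 2"
    have \<theta>: "\<theta> = pi * real p * of_int (int (Suc n) - int k) / real q"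
      unfolding \<theta>_def by (rule chord_angle_diff)
    have "sin \<theta> \<noteq> 0"
      unfolding \<theta> using assms k by (intro sin_ne_0_if_not_multiple) auto
    then have "ball 0 R \<inter> chord_line R p q (Suc n) \<inter> chord_line R p q k \<noteq> {}
        \<longleftrightarrow> cos (pi * real p / real q) < \<bar>cos \<theta>\<bar>"
      using half_angle_bounds[OF assms(2,3)] \<open>R > 0\<close> \<theta>_def by (intro crosses_iff)
    also have "\<theta> = pi * real p * real (Suc n - k) / real q"
      using k by (simp add: \<theta> of_nat_diff)
    also have "cos (pi * real p / real q) < \<bar>cos (pi * real p * real (Suc n - k) / real q)\<bar>
        \<longleftrightarrow> p * (Suc n - k) mod q < p \<or> q < p * (Suc n - k) mod q + p"
      using assms by (intro cos_less_abs_cos_iff) auto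
    finally show "ball 0 R \<inter> chord_line R p q (Suc n) \<inter> chord_line R p q k \<noteq> {}
        \<longleftrightarrow> p * (Suc n - k) mod q < p \<or> q < p * (Suc n - k) mod q + p" .
  qed
  also have "card \<dots> = card {d\<in>{1..n}. p * d mod q < p \<or> q < p * d mod q + p}"
    by (rule bij_betw_same_card[of "\<lambda>k. Suc n - k"], rule bij_betw_byWitness[of _ "\<lambda>k. Suc n - k"]) auto
  finally show ?thesis by simp
qed

text \<open>Let \<open>s\<close> be the residue of \<open>p * Suc n\<close>. From \<open>n\<close>
  to \<open>Suc n\<close> the first quotient grows exactly if \<open>s < p\<close>, the second
  exactly if \<open>q < s + p\<close>. As \<open>2 * p < q\<close>, these cases exclude each other,
  so their sum counts \<open>Suc n\<close> correctly.\<close>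

lemma card_crossings:
  assumes "p > 0" "2 * p < q" "coprime p q" "n < q"
  shows "card {d\<in>{1..n}. p * d mod q < p \<or> q < p * d mod q + p} = p * n div q + (p * Suc n - 1) div q"
  using \<open>n < q\<close>
proof (induction n)
  case 0
  then show ?case using assms by simp
next
  case (Suc n)
  define b s where "b = p * Suc n div q" and "s = p * Suc n mod q"
  have bs: "p * Suc n = q * b + s" by (simp add: b_def s_def)
  have "s < q" using assms by (simp add: s_def)
  \<comment> \<open>Coprimality keeps \<open>s\<close> positive until the orbit closes; so the
    \<open>- 1\<close> in the second quotient leaves the value \<open>b\<close> unchanged.\<close>
  have "\<not> q dvd p * Suc n"
    using Suc.prems \<open>coprime p q\<close>
    by (metis coprime_commute coprime_dvd_mult_right_iff dvd_imp_le not_le zero_less_Suc)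
  then have "s > 0" by (auto simp: s_def dvd_eq_mod_eq_0)
  have "{d\<in>{1..Suc n}. p * d mod q < p \<or> q < p * d mod q + p}
    = (if s < p \<or> q < s + p then insert (Suc n) else id) {d\<in>{1..n}. p * d mod q < p \<or> q < p * d mod q + p}"
    unfolding s_def by (auto simp: le_Suc_eq)
  then have card: "card {d\<in>{1..Suc n}. p * d mod q < p \<or> q < p * d mod q + p}
    = p * n div q + (p * Suc n - 1) div q + (if s < p then 1 else 0) + (if q < s + p then 1 else 0)"
    using Suc assms by simp
  have "(p * Suc n - 1) div q = b"
    using bs \<open>s > 0\<close> \<open>s < q\<close> by (intro div_nat_eqI) auto
  moreover have "p * n div q + (if s < p then 1 else 0) = b"
  proof (cases "s < p")
    case True
    then have "b \<noteq> 0" using bs by (intro notI) simp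
    then obtain c where c: "b = Suc c" by (cases b) auto
    have "p * n div q = c"
      using bs c True \<open>2 * p < q\<close> by (intro div_nat_eqI) (auto simp: algebra_simps)
    then show ?thesis using True c by simp
  next
    case False
    have "p * n div q = b"
      using bs False \<open>s < q\<close> by (intro div_nat_eqI) (auto simp: algebra_simps)
    then show ?thesis using False by simp
  qed
  moreover have "(p * Suc (Suc n) - 1) div q = b + (if q < s + p then 1 else 0)"
    using bs \<open>s > 0\<close> \<open>s < q\<close> \<open>2 * p < q\<close> by (intro div_nat_eqI) (auto simp: algebra_simps)
  ultimately show ?case
    unfolding card by (simp add: b_def)
qed

lemma num_regions_Suc:
  assumes "R > 0" "p > 0" "2 * p < q" "coprime p q" "n < q"
  shows "num_regions R p q (Suc n)
    = num_regions R p q n + 1 + p * n div q + (p * Suc n - 1) div q"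
  using num_regions_Suc_crossings[OF assms] card_crossings[OF assms(2-5)] by simp

section \<open>The division sequence\<close>

text \<open>Indexed from 0: the value at \<open>n\<close> belongs to path \<open>n + 1\<close>. The
  quotients are the numbers of full turns completed at the start of this path and strictly before
  its end.\<close>

definition regions_inc :: "nat \<Rightarrow> nat \<Rightarrow> nat \<Rightarrow> nat" where
  "regions_inc p q n = 1 + p * n div q + (p * Suc n - 1) div q"

lemma num_regions_eq_sum:
  assumes "R > 0" "p > 0" "2 * p < q" "coprime p q" "n \<le> q"
  shows "num_regions R p q n = 1 + (\<Sum>i<n. regions_inc p q i)"
  using \<open>n \<le> q\<close>
  by (induction n) (simp_all add: num_regions_0 num_regions_Suc assms regions_inc_def)

text \<open>The total comes from pairing path \<open>i + 1\<close> with path \<open>q - i\<close>.\<close>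

lemma sum_regions_inc:
  assumes "p > 0" "q > 0"
  shows "(\<Sum>i<q. regions_inc p q i) = p * q"
proof -
  \<comment> \<open>If \<open>p * Suc i = q * b + s + 1\<close>, the complementary multiple
    \<open>p * (q - Suc i)\<close> has the quotient \<open>p - 1 - b\<close>.\<close>
  have pair: "p * (q - Suc i) div q + (p * Suc i - 1) div q = p - 1" if "i < q" for i
  proof -
    define b s where "b = (p * Suc i - 1) div q" and "s = (p * Suc i - 1) mod q"
    have "p * Suc i - 1 = q * b + s" by (simp add: b_def s_def)
    moreover have "p * Suc i > 0" using \<open>p > 0\<close> by simp
    ultimately have bs: "p * Suc i = q * b + s + 1" by linarith
    have "s < q" using \<open>q > 0\<close> by (simp add: s_def)
    have "p * Suc i \<le> p * q" using that by (intro mult_le_mono) auto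
    then have "q * b < q * p" using bs mult.commute[of p q] by linarith
    then have "b < p" by simp
    then obtain c where c: "p = b + Suc c" using less_imp_Suc_add by auto
    have "p * (q - Suc i) + p * Suc i = p * q"
      using that unfolding distrib_left[symmetric] by simp
    then have "p * (q - Suc i) + s + 1 = q * c + q"
      using bs c by (simp add: algebra_simps)
    then have "p * (q - Suc i) div q = c"
      using \<open>s < q\<close> by (intro div_nat_eqI) auto
    moreover have "p - 1 = c + b" using c by simp
    ultimately show ?thesis by (simp only: b_def)
  qed
  have "(\<Sum>i<q. regions_inc p q i) = q + (\<Sum>i<q. p * i div q) + (\<Sum>i<q. (p * Suc i - 1) div q)"
    by (simp add: regions_inc_def sum_Suc sum.distrib del: mult_Suc_right)
  also have "(\<Sum>i<q. p * i div q) = (\<Sum>i<q. p * (q - Suc i) div q)"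
    by (rule sum.nat_diff_reindex[symmetric])
  also have "q + \<dots> + (\<Sum>i<q. (p * Suc i - 1) div q)
      = q + (\<Sum>i<q. p * (q - Suc i) div q + (p * Suc i - 1) div q)"
    by (simp only: sum.distrib add.assoc)
  also have "\<dots> = q + q * (p - 1)"
    using pair by simp
  also have "\<dots> = p * q" using \<open>p > 0\<close> by (cases p) auto
  finally show ?thesis .
qed

section \<open>Blocks of increments, one per turn\<close>

context
  fixes p q m r :: nat
  assumes p: "p \<ge> 2" and coprime: "coprime p q" and q: "q = m * p + r"
    and m: "m \<ge> 2" and r: "0 < r" "r < p"
begin

text \<open>The number of paths completed by the time the total angle reaches \<open>2 * pi * k\<close>; it equals
  \<open>k * q div p\<close>.\<close>

definition block_end :: "nat \<Rightarrow> nat" where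
  "block_end k = k * m + k * r div p"

text \<open>Together with \<open>less_block_end\<close> this places the end of turn \<open>k\<close>
  on path \<open>block_end k + 1\<close>, possibly at its start.\<close>

lemma block_end_le: "p * block_end k \<le> k * q"
  using times_div_less_eq_dividend[of p "k * r"] by (simp add: block_end_def q algebra_simps)

lemma less_block_end: "k * q < p * Suc (block_end k)"
  using dividend_less_times_div[of p "k * r"] p by (simp add: block_end_def q algebra_simps)

text \<open>Since \<open>p\<close> does not divide \<open>k * q\<close>, a turn before the last one
  never ends at a reflection.\<close>

lemma block_end_less:
  assumes "0 < k" "k < p"
  shows "p * block_end k < k * q"
proof -
  have "\<not> p dvd k * q"
    using assms coprime by (metis coprime_dvd_mult_left_iff dvd_imp_le not_le)
  then show ?thesis
    using block_end_le[of k] by (metis dvd_triv_left nat_less_le)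
qed

text \<open>Such a path stays within one turn, so both quotients equal \<open>k\<close>. Equality in
  the second assumption covers the very last path, which ends exactly at the starting point.\<close>

lemma regions_inc_inside:
  assumes "k * q \<le> p * n" "p * Suc n \<le> Suc k * q"
  shows "regions_inc p q n = 2 * k + 1"
proof -
  have "p * n div q = k"
    using assms p by (intro div_nat_eqI) (auto simp: algebra_simps)
  moreover have "(p * Suc n - 1) div q = k"
    using assms p by (intro div_nat_eqI) (auto simp: algebra_simps)
  ultimately show ?thesis by (simp add: regions_inc_def)
qed

lemma p_less_q: "2 * p < q"
proof -
  have "2 * p \<le> m * p" using m by (rule mult_le_mono1)
  then show ?thesis using q r by linarith
qed

text \<open>This path straddles the end of turn \<open>k\<close>: the quotients are
  \<open>k - 1\<close> and \<open>k\<close>, and \<open>1 + (k - 1) + k = 2 * k\<close>.\<close>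

lemma regions_inc_block_end:
  assumes "0 < k" "k < p"
  shows "regions_inc p q (block_end k) = 2 * k"
proof -
  obtain j where k: "k = Suc j" using assms by (cases k) auto
  have "p * block_end k div q = j"
    using block_end_less[OF assms] less_block_end[of k] p_less_q k
    by (intro div_nat_eqI) (auto simp: algebra_simps)
  moreover have "(p * Suc (block_end k) - 1) div q = k"
    using block_end_less[OF assms] less_block_end[of k] p_less_q
    by (intro div_nat_eqI) (auto simp: algebra_simps)
  ultimately show ?thesis by (simp add: regions_inc_def k)
qed

lemma block_end_Suc_gt: "block_end k < block_end (Suc k)"
  using m div_le_mono[of "k * r" "Suc k * r" p] by (simp add: block_end_def)

text \<open>After the straddling path at its front, the block consists of paths within one
  turn.\<close>

lemma regions_inc_block:
  assumes "0 < k" "k < p"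
  shows "map (regions_inc p q) [block_end k..<block_end (Suc k)]
    = 2 * k # replicate (block_end (Suc k) - Suc (block_end k)) (2 * k + 1)"
proof -
  have "regions_inc p q n = 2 * k + 1" if "n \<in> {Suc (block_end k)..<block_end (Suc k)}" for n
  proof (rule regions_inc_inside)
    have "p * Suc (block_end k) \<le> p * n" using that by (intro mult_le_mono) auto
    then show "k * q \<le> p * n" using less_block_end[of k] by linarith
    have "p * Suc n \<le> p * block_end (Suc k)" using that by (intro mult_le_mono) auto
    then show "p * Suc n \<le> Suc k * q" using block_end_le[of "Suc k"] by linarith
  qed
  then have "map (regions_inc p q) [Suc (block_end k)..<block_end (Suc k)]
      = map (\<lambda>_. 2 * k + 1) [Suc (block_end k)..<block_end (Suc k)]"
    by (intro map_cong) auto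
  then show ?thesis
    using regions_inc_block_end[OF assms] block_end_Suc_gt[of k]
    by (simp add: upt_conv_Cons map_replicate_const)
qed

lemma block_end_1: "block_end 1 = m"
  using r by (simp add: block_end_def)

lemma block_end_p: "block_end p = q"
  using r by (simp add: block_end_def q)

text \<open>The orbit starts at a reflection point, so this block has no straddling path at its
  front.\<close>

lemma regions_inc_first_block: "map (regions_inc p q) [0..<m] = replicate m 1"
proof -
  have "regions_inc p q n = 1" if "n < m" for n
  proof -
    have "p * Suc n \<le> p * m" using that by (intro mult_le_mono) auto
    then have "p * Suc n \<le> Suc 0 * q" using q mult.commute[of m p] by linarith
    then show ?thesis using regions_inc_inside[of 0 n] by simp
  qed
  then have "map (regions_inc p q) [0..<m] = map (\<lambda>_. 1) [0..<m]"
    by (intro map_cong) auto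
  then show ?thesis by (simp add: map_replicate_const)
qed

lemma block_end_mono: "k \<le> l \<Longrightarrow> block_end k \<le> block_end l"
  by (rule lift_Suc_mono_le[of block_end]) (use block_end_Suc_gt less_imp_le in blast)+

text \<open>A block is now indexed by its upper end \<open>block_end j\<close>, as in the closed
  formula, and no longer by its lower end.\<close>

lemma regions_inc_blocks:
  assumes "1 \<le> k" "k \<le> p"
  shows "map (regions_inc p q) [0..<block_end k] = replicate m 1 @
    concat (map (\<lambda>j. 2 * (j - 1) # replicate (block_end j - Suc (block_end (j - 1))) (2 * j - 1)) [2..<Suc k])"
  using assms
proof (induction k rule: dec_induct)
  case base
  show ?case unfolding block_end_1 by (simp add: regions_inc_first_block del: One_nat_def)
next
  case (step k)
  have "[0..<block_end (Suc k)] = [0..<block_end k] @ [block_end k..<block_end (Suc k)]"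
    using upt_add_eq_append[of 0 "block_end k" "block_end (Suc k) - block_end k"] block_end_Suc_gt[of k] by simp
  then show ?case
    using step regions_inc_block[of k] by simp
qed

lemma sum_list_concat: "sum_list (concat xss) = sum_list (map sum_list xss)"
  by (induction xss) auto

lemma sum_regions_inc_blocks:
  assumes "1 \<le> k" "k \<le> p"
  shows "(\<Sum>i<block_end k. regions_inc p q i) =
    m + (\<Sum>j=2..<Suc k. 2 * (j - 1) + (block_end j - Suc (block_end (j - 1))) * (2 * j - 1))"
proof -
  have "(\<Sum>i<block_end k. regions_inc p q i) = sum_list (map (regions_inc p q) [0..<block_end k])"
    by (simp add: interv_sum_list_conv_sum_set_nat atLeast0LessThan)
  also have "\<dots> = m + sum_list (map (\<lambda>j. 2 * (j - 1) + (block_end j - Suc (block_end (j - 1))) * (2 * j - 1)) [2..<Suc k])"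
    unfolding regions_inc_blocks[OF assms]
    by (simp add: sum_list_concat sum_list_replicate o_def del: upt_Suc)
  finally show ?thesis by (simp only: interv_sum_list_conv_sum_set_nat set_upt)
qed

end

section \<open>Assembly of the closed formulas\<close>

theorem mainTheorem2:
  fixes R :: real and p q m r :: nat
  assumes "R > 0"
    and "p \<ge> 2" and "q > 0" and "coprime p q" and "real p / real q < 1 / 2"
    and "q = m * p + r" and "m = q div p" and "r \<in> {1..p - 1}"
  shows
    "num_regions_total R p q =
       1 + (\<Sum>n = 1..m + r div p. 1)
         + (\<Sum>k = 2..<p. 2 * (k - 1)
              + (\<Sum>n = (k - 1) * m + 2 + ((k - 1) * r) div p..k * m + (k * r) div p. 2 * k - 1))
         + 2 * (p - 1)
         + (\<Sum>n = (p - 1) * m + 2 + ((p - 1) * r) div p..p * m + r. 2 * p - 1)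
     \<and> num_regions R p q 0 = 1
     \<and> increments (num_regions R p q) q =
         replicate m 1
         @ concat (map (\<lambda>k. (2 * (int k - 1))
                          # replicate (m - 1 + (k * r) div p - ((k - 1) * r) div p) (2 * int k - 1))
                       [2..<p + 1])
     \<and> num_regions R p q m = m + 1
     \<and> num_regions R p q (m + 1) = m + 3
     \<and> num_regions R p q (m + 1 + (m - 1 + (2 * r) div p - r div p))
         = m + 3 + 3 * (m - 1 + (2 * r) div p - r div p)
     \<and> num_regions R p q q = p * (m * p + r) + 1
     \<and> num_regions_total R p q = p * q + 1"
proof -
  have r: "0 < r" "r < p" using \<open>r \<in> {1..p - 1}\<close> by auto
  have pq: "p > 0" "2 * p < q"
  proof -
    have "2 * real p < real q" using \<open>real p / real q < 1 / 2\<close> \<open>q > 0\<close> by (simp add: field_simps)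
    then show "2 * p < q" by linarith
  qed (use \<open>p \<ge> 2\<close> in simp)
  \<comment> \<open>The condition \<open>p / q < 1 / 2\<close> enters the block lemmas in this
    form.\<close>
  have m: "m \<ge> 2"
    using div_le_mono[of "2 * p" q p] pq \<open>m = q div p\<close> by simp
  note ctxt = \<open>p \<ge> 2\<close> \<open>coprime p q\<close> \<open>q = m * p + r\<close> m r
  note regions = num_regions_eq_sum[OF \<open>R > 0\<close> pq \<open>coprime p q\<close>]
  define e where "e = block_end p m r"
  have e: "e k = k * m + k * r div p" for k
    unfolding e_def by (rule block_end_def[OF ctxt])
  have e1: "e 1 = m" and ep: "e p = q"
    unfolding e_def by (rule block_end_1[OF ctxt] block_end_p[OF ctxt])+
  have e_less: "e k < e (Suc k)" for k
    unfolding e_def by (rule block_end_Suc_gt[OF ctxt])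
  have e_mono: "e k \<le> e l" if "k \<le> l" for k l
    unfolding e_def using that by (rule block_end_mono[OF ctxt])
  \<comment> \<open>As \<open>m\<close> is positive, the truncated subtraction of 1 may be moved
    into \<open>m - 1\<close>.\<close>
  have gap: "e k - Suc (e (k - 1)) = m - 1 + (k * r) div p - ((k - 1) * r) div p" if "k \<ge> 2" for k
  proof -
    from \<open>k \<ge> 2\<close> obtain j where "k = Suc j" by (cases k) auto
    then show ?thesis using m by (simp add: e)
  qed
  have blocks: "num_regions R p q (e k) =
      1 + m + (\<Sum>j=2..<Suc k. 2 * (j - 1) + (e j - Suc (e (j - 1))) * (2 * j - 1))"
    if "1 \<le> k" "k \<le> p" for k
    using regions[of "e k"] sum_regions_inc_blocks[OF ctxt that] e_mono[OF \<open>k \<le> p\<close>]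
    by (simp add: ep flip: e_def)
  \<comment> \<open>The pairing argument gives this value directly, without the block sums.\<close>
  have total: "num_regions R p q q = p * q + 1"
    using regions[of q] sum_regions_inc[of p q] pq by simp
  have inner: "(\<Sum>n = (k - 1) * m + 2 + ((k - 1) * r) div p..k * m + (k * r) div p. 2 * k - 1)
      = (e k - Suc (e (k - 1))) * (2 * k - 1)" for k
  proof -
    \<comment> \<open>Path \<open>e (k - 1) + 1\<close> is the straddling one, so the terms
      \<open>2 * k - 1\<close> start with path \<open>e (k - 1) + 2\<close>.\<close>
    have "(k - 1) * m + 2 + ((k - 1) * r) div p = Suc (Suc (e (k - 1)))" by (simp add: e)
    then show ?thesis by (simp add: e[of k])
  qed
  have sums: "num_regions_total R p q =
       1 + (\<Sum>n = 1..m + r div p. 1)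
         + (\<Sum>k = 2..<p. 2 * (k - 1)
              + (\<Sum>n = (k - 1) * m + 2 + ((k - 1) * r) div p..k * m + (k * r) div p. 2 * k - 1))
         + 2 * (p - 1)
         + (\<Sum>n = (p - 1) * m + 2 + ((p - 1) * r) div p..p * m + r. 2 * p - 1)"
  proof -
    \<comment> \<open>The last sum thus has the same shape as the others, at
      \<open>k = p\<close>.\<close>
    have "p * m + r = p * m + (p * r) div p" using r by simp
    then have last: "(\<Sum>n = (p - 1) * m + 2 + ((p - 1) * r) div p..p * m + r. 2 * p - 1)
        = (e p - Suc (e (p - 1))) * (2 * p - 1)"
      using inner[of p] by simp
    show ?thesis
      unfolding num_regions_total_def inner last
      using blocks[of p] \<open>p \<ge> 2\<close> r by (simp add: ep)
  qed
  have incs: "increments (num_regions R p q) q =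
         replicate m 1
         @ concat (map (\<lambda>k. (2 * (int k - 1))
                          # replicate (m - 1 + (k * r) div p - ((k - 1) * r) div p) (2 * int k - 1))
                       [2..<p + 1])"
  proof -
    have "increments (num_regions R p q) q = map int (map (regions_inc p q) [0..<q])"
    proof -
      \<comment> \<open>Path numbers start at 1, the indices of \<open>regions_inc\<close> at
        0.\<close>
      have "[1..<q + 1] = map Suc [0..<q]" by (simp add: map_Suc_upt)
      moreover have "int (num_regions R p q (Suc n)) - int (num_regions R p q n) = int (regions_inc p q n)"
        if "n < q" for n
        using that regions[of n] regions[of "Suc n"] by simp
      ultimately show ?thesis by (simp add: increments_def)
    qed
    also have "map (regions_inc p q) [0..<q] = replicate m 1 @
        concat (map (\<lambda>j. 2 * (j - 1) # replicate (e j - Suc (e (j - 1))) (2 * j - 1)) [2..<Suc p])"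
      using regions_inc_blocks[OF ctxt, of p] \<open>p \<ge> 2\<close> by (simp add: ep del: upt_Suc flip: e_def)
    also have "map int \<dots> = replicate m 1 @ concat (map (\<lambda>k. (2 * (int k - 1))
                # replicate (m - 1 + (k * r) div p - ((k - 1) * r) div p) (2 * int k - 1)) [2..<p + 1])"
    proof -
      \<comment> \<open>For \<open>k \<ge> 2\<close> the subtractions on natural numbers in these
        terms are exact and carry over to the integers.\<close>
      have "map int (2 * (k - 1) # replicate (e k - Suc (e (k - 1))) (2 * k - 1))
          = (2 * (int k - 1)) # replicate (m - 1 + (k * r) div p - ((k - 1) * r) div p) (2 * int k - 1)"
        if "k \<ge> 2" for k
        using that unfolding gap[OF that] by (simp add: of_nat_diff)
      then show ?thesis
        unfolding map_append map_concat map_map map_replicate Suc_eq_plus1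
        by (intro arg_cong2[of _ _ _ _ append] arg_cong[of _ _ concat] map_cong) auto
    qed
    finally show ?thesis .
  qed
  have fm: "num_regions R p q m = m + 1"
    using blocks[of 1] \<open>p \<ge> 2\<close> by (simp add: e1[unfolded One_nat_def])
  \<comment> \<open>Path \<open>m + 1\<close> is the first to straddle the end of a turn.\<close>
  have inc_m: "regions_inc p q m = 2"
    using regions_inc_block_end[OF ctxt, of 1] \<open>p \<ge> 2\<close> e1 by (simp add: e_def)
  have "m < q" using e_less[of 1] e_mono[of 2 p] \<open>p \<ge> 2\<close> e1 ep by (simp add: numeral_2_eq_2)
  then have fm1: "num_regions R p q (m + 1) = m + 3"
    using regions[of m] regions[of "Suc m"] fm inc_m by simp
  \<comment> \<open>The index in the statement is the end of the second block.\<close>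
  have "e 2 = m + 1 + (m - 1 + (2 * r) div p - r div p)"
    using m r by (simp add: e)
  moreover have "num_regions R p q (e 2) = m + 3 + 3 * (m - 1 + (2 * r) div p - r div p)"
    using blocks[of 2] gap[of 2] \<open>p \<ge> 2\<close> by (simp add: numeral_2_eq_2)
  ultimately have f2: "num_regions R p q (m + 1 + (m - 1 + (2 * r) div p - r div p))
         = m + 3 + 3 * (m - 1 + (2 * r) div p - r div p)" by simp
  show ?thesis
    using sums incs fm fm1 f2 total num_regions_0[OF \<open>R > 0\<close> pq] \<open>q = m * p + r\<close>
    by (simp add: num_regions_total_def)
qed

end
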